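(* Let $\mathcal{B},\mathcal{C}$ be polarities and let $R$ be a compatible relation from $\mathcal{B}$ to $\mathcal{C}$, regarded as a morphism $R:\mathcal{B}\to\mathcal{C}$ of $\mathbf{Pol}$. Then $R$ is a monomorphism in $\mathbf{Pol}$ if and only if $R^{\downarrow}R^{\uparrow}\leq\mathrm{cl}_{\mathcal{B}}$. Similarly, $R$ is an epimorphism in $\mathbf{Pol}$ if and only if $\mathrm{cl}^{\mathcal{C}}\geq R^{\uparrow}R^{\downarrow}$.
   Context: For a binary relation $R\subseteq A\times B$ between sets, define antitone maps $R^{\downarrow}:\mathcal{P}(B)\to\mathcal{P}(A)$ and $R^{\uparrow}:\mathcal{P}(A)\to\mathcal{P}(B)$ by $R^{\downarrow}(Y)=\{a\in A\mid a\mathrel{R}\beta\text{ for all }\beta\in Y\}$ and $R^{\uparrow}(X)=\{\beta\in B\mid a\mathrel{R}\beta\text{ for all }a\in X\}$. Juxtaposition of such maps denotes composition, the rightmost map being applied first; maps between powersets are ordered pointwise by inclusion. A polarity $\mathcal{A}=(A^-,A^+;\mathcal{A})$ consists of two sets $A^-,A^+$ and a binary relation $\mathcal{A}\subseteq A^-\times A^+$ (its incidence relation, denoted by the same letter). Put $\mathrm{cl}_{\mathcal{A}}=\mathcal{A}^{\downarrow}\mathcal{A}^{\uparrow}$ on $\mathcal{P}(A^-)$ and $\mathrm{cl}^{\mathcal{A}}=\mathcal{A}^{\uparrow}\mathcal{A}^{\downarrow}$ on $\mathcal{P}(A^+)$. For polarities $\mathcal{A},\mathcal{B}$, a relation $R\subseteq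 A^-\times B^+$ is a compatible relation from $\mathcal{A}$ to $\mathcal{B}$ if $\mathrm{cl}_{\mathcal{A}}R^{\downarrow}=R^{\downarrow}$ and $R^{\downarrow}\mathrm{cl}^{\mathcal{B}}=R^{\downarrow}$. $\mathbf{Pol}$ is the category whose objects are polarities and whose morphisms $\mathcal{A}\to\mathcal{B}$ are the compatible relations from $\mathcal{A}$ to $\mathcal{B}$. The composite of $R:\mathcal{A}\to\mathcal{B}$ and $S:\mathcal{B}\to\mathcal{C}$ (written in diagrammatic order) is the relation $R\mathbin{;}S\subseteq A^-\times C^+$ with $a\mathrel{(R\mathbin{;}S)}\gamma$ if and only if $a\in R^{\downarrow}\mathcal{B}^{\uparrow}S^{\downarrow}(\{\gamma\})$. The identity on $\mathcal{A}$ is its incidence relation. *)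

theory Defs
  imports Main
begin

text \<open>
  The relation \<open>R\<close> below is a subset of \<open>A \<times> B\<close>. The carrier that the image lives in is an explicit
  argument, since it determines the value at the empty set: \<open>down A R\<close> is the map
  \<open>R\<^sup>\<down> : Pow B \<rightarrow> Pow A\<close> and \<open>up B R\<close> is the map \<open>R\<^sup>\<up> : Pow A \<rightarrow> Pow B\<close>.
\<close>

definition down :: "'a set \<Rightarrow> ('a \<times> 'b) set \<Rightarrow> 'b set \<Rightarrow> 'a set" where
  "down A R Y = {a \<in> A. \<forall>\<beta>\<in>Y. (a, \<beta>) \<in> R}"

definition up :: "'b set \<Rightarrow> ('a \<times> 'b) set \<Rightarrow> 'a set \<Rightarrow> 'b set" where
  "up B R X = {\<beta> \<in> B. \<forall>a\<in>X. (a, \<beta>) \<in> R}"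

record ('a, 'b) polarity =
  Neg :: "'a set"
  Pos :: "'b set"
  Inc :: "('a \<times> 'b) set"

definition is_polarity :: "('a, 'b) polarity \<Rightarrow> bool" where
  "is_polarity \<A> \<longleftrightarrow> Inc \<A> \<subseteq> Neg \<A> \<times> Pos \<A>"

definition cl_neg :: "('a, 'b) polarity \<Rightarrow> 'a set \<Rightarrow> 'a set" where
  "cl_neg \<A> X = down (Neg \<A>) (Inc \<A>) (up (Pos \<A>) (Inc \<A>) X)"

definition cl_pos :: "('a, 'b) polarity \<Rightarrow> 'b set \<Rightarrow> 'b set" where
  "cl_pos \<A> Y = up (Pos \<A>) (Inc \<A>) (down (Neg \<A>) (Inc \<A>) Y)"

definition compatible :: "('a, 'b) polarity \<Rightarrow> ('c, 'd) polarity \<Rightarrow> ('a \<times> 'd) set \<Rightarrow> bool" where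
  "compatible \<A> \<B> R \<longleftrightarrow>
     R \<subseteq> Neg \<A> \<times> Pos \<B> \<and>
     (\<forall>Y\<subseteq>Pos \<B>. cl_neg \<A> (down (Neg \<A>) R Y) = down (Neg \<A>) R Y) \<and>
     (\<forall>Y\<subseteq>Pos \<B>. down (Neg \<A>) R (cl_pos \<B> Y) = down (Neg \<A>) R Y)"

definition pol_comp ::
  "('a, 'b) polarity \<Rightarrow> ('c, 'd) polarity \<Rightarrow> ('e, 'f) polarity \<Rightarrow>
   ('a \<times> 'd) set \<Rightarrow> ('c \<times> 'f) set \<Rightarrow> ('a \<times> 'f) set" where
  "pol_comp \<A> \<B> \<C> R S =
     {(a, \<gamma>) \<in> Neg \<A> \<times> Pos \<C>.
        a \<in> down (Neg \<A>) R (up (Pos \<B>) (Inc \<B>) (down (Neg \<B>) S {\<gamma>}))}"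

lemma down_pol_comp:
  assumes R: "compatible \<A> \<B> R" and S: "compatible \<B> \<C> S" and Y: "Y \<subseteq> Pos \<C>"
  shows "down (Neg \<A>) (pol_comp \<A> \<B> \<C> R S) Y =
         down (Neg \<A>) R (up (Pos \<B>) (Inc \<B>) (down (Neg \<B>) S Y))"
proof -
  define W where "W = (\<Union>\<gamma>\<in>Y. up (Pos \<B>) (Inc \<B>) (down (Neg \<B>) S {\<gamma>}))"
  have W: "W \<subseteq> Pos \<B>"
    by (auto simp: W_def up_def)
  have "down (Neg \<A>) (pol_comp \<A> \<B> \<C> R S) Y = down (Neg \<A>) R W"
    using Y by (auto simp: down_def pol_comp_def W_def)
  also have "\<dots> = down (Neg \<A>) R (cl_pos \<B> W)"
    using R W by (auto simp: compatible_def)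
  also have "down (Neg \<B>) (Inc \<B>) W = down (Neg \<B>) S Y"
  proof -
    have "down (Neg \<B>) (Inc \<B>) W = Neg \<B> \<inter> (\<Inter>\<gamma>\<in>Y. cl_neg \<B> (down (Neg \<B>) S {\<gamma>}))"
      by (auto simp: W_def cl_neg_def down_def)
    also have "\<dots> = Neg \<B> \<inter> (\<Inter>\<gamma>\<in>Y. down (Neg \<B>) S {\<gamma>})"
      using S Y by (simp add: compatible_def subset_iff)
    also have "\<dots> = down (Neg \<B>) S Y"
      by (auto simp: down_def)
    finally show ?thesis .
  qed
  then have "cl_pos \<B> W = up (Pos \<B>) (Inc \<B>) (down (Neg \<B>) S Y)"
    by (simp add: cl_pos_def)
  finally show ?thesis .
qed

lemma compatible_pol_comp:
  assumes R: "compatible \<A> \<B> R" and S: "compatible \<B> \<C> S"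
  shows "compatible \<A> \<C> (pol_comp \<A> \<B> \<C> R S)"
proof -
  have up: "up (Pos \<B>) (Inc \<B>) X \<subseteq> Pos \<B>" for X
    by (auto simp: up_def)
  have cl: "cl_pos \<C> Y \<subseteq> Pos \<C>" for Y
    by (auto simp: cl_pos_def up_def)
  have "pol_comp \<A> \<B> \<C> R S \<subseteq> Neg \<A> \<times> Pos \<C>"
    by (auto simp: pol_comp_def)
  then show ?thesis
    using R S up by (simp add: compatible_def[of \<A> \<C>] down_pol_comp[OF R S] cl)
      (simp add: compatible_def)
qed

lemma compatible_Inc: "is_polarity \<A> \<Longrightarrow> compatible \<A> \<A> (Inc \<A>)"
  unfolding compatible_def is_polarity_def cl_neg_def cl_pos_def down_def up_def by blast

lemma pol_comp_Inc_left:
  assumes "compatible \<A> \<B> R"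
  shows "pol_comp \<A> \<A> \<B> (Inc \<A>) R = R"
proof -
  have "down (Neg \<A>) (Inc \<A>) (up (Pos \<A>) (Inc \<A>) (down (Neg \<A>) R {\<gamma>})) = down (Neg \<A>) R {\<gamma>}"
    if "\<gamma> \<in> Pos \<B>" for \<gamma>
    using assms that by (simp add: compatible_def cl_neg_def)
  then show ?thesis
    using assms by (auto simp: pol_comp_def compatible_def down_def)
qed

lemma pol_comp_Inc_right:
  assumes "compatible \<A> \<B> R"
  shows "pol_comp \<A> \<B> \<B> R (Inc \<B>) = R"
proof -
  have "down (Neg \<A>) R (up (Pos \<B>) (Inc \<B>) (down (Neg \<B>) (Inc \<B>) {\<gamma>})) = down (Neg \<A>) R {\<gamma>}"
    if "\<gamma> \<in> Pos \<B>" for \<gamma>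
    using assms that by (simp add: compatible_def cl_pos_def)
  then show ?thesis
    using assms by (auto simp: pol_comp_def compatible_def down_def)
qed

lemma pol_comp_assoc:
  assumes R: "compatible \<A> \<B> R" and S: "compatible \<B> \<C> S" and T: "compatible \<C> \<D> T"
  shows "pol_comp \<A> \<C> \<D> (pol_comp \<A> \<B> \<C> R S) T = pol_comp \<A> \<B> \<D> R (pol_comp \<B> \<C> \<D> S T)"
proof -
  have "up (Pos \<C>) (Inc \<C>) X \<subseteq> Pos \<C>" for X
    by (auto simp: up_def)
  then show ?thesis
    by (auto simp: pol_comp_def[of \<A> \<C> \<D>] pol_comp_def[of \<A> \<B> \<D>]
        down_pol_comp[OF R S] down_pol_comp[OF S T])
qed

text \<open>
  Monomorphisms and epimorphisms of \<open>Pol\<close>. A formula of HOL cannot quantify over types, so the types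
  \<open>'x\<close>, \<open>'y\<close> in which the carriers of the test object live are a parameter, passed as a type token.
  A theorem in which \<open>'x\<close>, \<open>'y\<close> are left free speaks about all test types; taking all type parameters
  equal to one type \<open>'u\<close> gives the mono- and epimorphisms of the category of polarities whose carriers
  are subsets of \<open>'u\<close>.
\<close>

definition pol_mono ::
  "('x, 'y) polarity itself \<Rightarrow> ('a, 'b) polarity \<Rightarrow> ('c, 'd) polarity \<Rightarrow> ('a \<times> 'd) set \<Rightarrow> bool" where
  "pol_mono tok \<B> \<C> R \<longleftrightarrow>
     compatible \<B> \<C> R \<and>
     (\<forall>(\<A> :: ('x, 'y) polarity) S T.
        is_polarity \<A> \<longrightarrow> compatible \<A> \<B> S \<longrightarrow> compatible \<A> \<B> T \<longrightarrow>
        pol_comp \<A> \<B> \<C> S R = pol_comp \<A> \<B> \<C> T R \<longrightarrow> S = T)"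

definition pol_epi ::
  "('x, 'y) polarity itself \<Rightarrow> ('a, 'b) polarity \<Rightarrow> ('c, 'd) polarity \<Rightarrow> ('a \<times> 'd) set \<Rightarrow> bool" where
  "pol_epi tok \<B> \<C> R \<longleftrightarrow>
     compatible \<B> \<C> R \<and>
     (\<forall>(\<D> :: ('x, 'y) polarity) S T.
        is_polarity \<D> \<longrightarrow> compatible \<C> \<D> S \<longrightarrow> compatible \<C> \<D> T \<longrightarrow>
        pol_comp \<B> \<C> \<D> R S = pol_comp \<B> \<C> \<D> R T \<longrightarrow> S = T)"

end

theory Submission
  imports Defs
begin

text \<open>
  The reason is that \<open>Pol\<close> has a test object: on the polarity with one element on each side and
  empty incidence, every subset is closed. Hence a morphism from it to \<open>\<B>\<close> is just a closed subset
  of \<open>\<B>\<^sup>+\<close>, or equivalently, through \<open>\<B>\<^sup>\<down>\<close>, a closed subset \<open>X\<close> of \<open>\<B>\<^sup>-\<close>, and postcomposition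
  with \<open>R\<close> turns \<open>X\<close> into \<open>R\<^sup>\<up> X\<close>. An arbitrary morphism \<open>S\<close> into \<open>\<B>\<close> is a family of such points, its
  rows, and composition acts row by row. Therefore \<open>R\<close> is a monomorphism exactly if \<open>R\<^sup>\<up>\<close> is injective
  on closed sets (\<open>pol_mono_iff_inj_on\<close>).

  Compatibility makes \<open>R\<^sup>\<up>\<close>, restricted to the closed sets, one half of a Galois connection whose other
  half is \<open>R\<^sup>\<down>\<close>. As for every Galois connection, the one half is injective if and only if the composite
  \<open>R\<^sup>\<down> R\<^sup>\<up>\<close> is the identity on closed sets, which for all sets says \<open>R\<^sup>\<down> R\<^sup>\<up> \<le> cl\<close>
  (\<open>inj_on_up_iff\<close>).

  Epimorphisms are treated in the same way, with columns instead of rows and \<open>R\<^sup>\<down>\<close> instead of \<open>R\<^sup>\<up>\<close>.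
\<close>

section \<open>The Galois connection of a relation\<close>

lemma up_antimono: "X \<subseteq> X' \<Longrightarrow> up B R X' \<subseteq> up B R X"
  by (auto simp: up_def)

lemma down_antimono: "Y \<subseteq> Y' \<Longrightarrow> down A R Y' \<subseteq> down A R Y"
  by (auto simp: down_def)

lemma up_subset: "up B R X \<subseteq> B"
  by (auto simp: up_def)

lemma down_subset: "down A R Y \<subseteq> A"
  by (auto simp: down_def)

lemma subset_up_iff_subset_down:
  "X \<subseteq> A \<Longrightarrow> Y \<subseteq> B \<Longrightarrow> Y \<subseteq> up B R X \<longleftrightarrow> X \<subseteq> down A R Y"
  by (auto simp: up_def down_def)

lemma up_down_up: "X \<subseteq> A \<Longrightarrow> up B R (down A R (up B R X)) = up B R X"
  by (auto simp: up_def down_def)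

lemma down_up_down: "Y \<subseteq> B \<Longrightarrow> down A R (up B R (down A R Y)) = down A R Y"
  by (auto simp: up_def down_def)

definition closed_neg :: "('a, 'b) polarity \<Rightarrow> 'a set set" where
  "closed_neg \<A> = {X. X \<subseteq> Neg \<A> \<and> cl_neg \<A> X = X}"

definition closed_pos :: "('a, 'b) polarity \<Rightarrow> 'b set set" where
  "closed_pos \<A> = {Y. Y \<subseteq> Pos \<A> \<and> cl_pos \<A> Y = Y}"

lemma down_Inc_closed: "Y \<subseteq> Pos \<A> \<Longrightarrow> down (Neg \<A>) (Inc \<A>) Y \<in> closed_neg \<A>"
  by (simp add: closed_neg_def cl_neg_def down_up_down down_subset)

lemma up_Inc_closed: "X \<subseteq> Neg \<A> \<Longrightarrow> up (Pos \<A>) (Inc \<A>) X \<in> closed_pos \<A>"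
  by (simp add: closed_pos_def cl_pos_def up_down_up up_subset)

lemma cl_neg_closed: "cl_neg \<A> X \<in> closed_neg \<A>"
  unfolding cl_neg_def by (intro down_Inc_closed up_subset)

lemma cl_pos_closed: "cl_pos \<A> Y \<in> closed_pos \<A>"
  unfolding cl_pos_def by (intro up_Inc_closed down_subset)

lemma cl_neg_mono: "X \<subseteq> X' \<Longrightarrow> cl_neg \<A> X \<subseteq> cl_neg \<A> X'"
  by (simp add: cl_neg_def down_antimono up_antimono)

lemma cl_pos_mono: "Y \<subseteq> Y' \<Longrightarrow> cl_pos \<A> Y \<subseteq> cl_pos \<A> Y'"
  by (simp add: cl_pos_def down_antimono up_antimono)

lemma subset_cl_neg: "X \<subseteq> Neg \<A> \<Longrightarrow> X \<subseteq> cl_neg \<A> X"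
  by (auto simp: cl_neg_def up_def down_def)

lemma subset_cl_pos: "Y \<subseteq> Pos \<A> \<Longrightarrow> Y \<subseteq> cl_pos \<A> Y"
  by (auto simp: cl_pos_def up_def down_def)

lemma inj_on_down_Inc: "inj_on (down (Neg \<A>) (Inc \<A>)) (closed_pos \<A>)"
  by (rule inj_on_inverseI[where g = "up (Pos \<A>) (Inc \<A>)"])
    (simp add: closed_pos_def cl_pos_def)

lemma inj_on_up_Inc: "inj_on (up (Pos \<A>) (Inc \<A>)) (closed_neg \<A>)"
  by (rule inj_on_inverseI[where g = "down (Neg \<A>) (Inc \<A>)"])
    (simp add: closed_neg_def cl_neg_def)

section \<open>Compatible relations through their rows and columns\<close>

lemma compatible_down_closed:
  "compatible \<A> \<B> R \<Longrightarrow> Y \<subseteq> Pos \<B> \<Longrightarrow> down (Neg \<A>) R Y \<in> closed_neg \<A>"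
  by (simp add: compatible_def closed_neg_def down_subset)

lemma compatible_down_cl_pos:
  "compatible \<A> \<B> R \<Longrightarrow> Y \<subseteq> Pos \<B> \<Longrightarrow> down (Neg \<A>) R (cl_pos \<B> Y) = down (Neg \<A>) R Y"
  by (simp add: compatible_def)

text \<open>
  Compatibility is defined through \<open>R\<^sup>\<down>\<close> alone, but the same two laws hold for \<open>R\<^sup>\<up>\<close>, because the Galois
  connection trades a law about arguments of \<open>R\<^sup>\<down>\<close> for one about values of \<open>R\<^sup>\<up>\<close>, and conversely.
\<close>

lemma compatible_up_closed:
  assumes R: "compatible \<A> \<B> R" and X: "X \<subseteq> Neg \<A>"
  shows "up (Pos \<B>) R X \<in> closed_pos \<B>"
proof -
  let ?Y = "up (Pos \<B>) R X"
  have "X \<subseteq> down (Neg \<A>) R ?Y"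
    using X by (auto simp: up_def down_def)
  then have "X \<subseteq> down (Neg \<A>) R (cl_pos \<B> ?Y)"
    by (simp add: compatible_down_cl_pos[OF R up_subset])
  then have "cl_pos \<B> ?Y \<subseteq> ?Y"
    unfolding cl_pos_def by (simp add: subset_up_iff_subset_down[OF X up_subset])
  then show ?thesis
    using subset_cl_pos[of ?Y \<B>] by (auto simp: closed_pos_def up_subset)
qed

lemma compatible_up_cl_neg:
  assumes R: "compatible \<A> \<B> R" and X: "X \<subseteq> Neg \<A>"
  shows "up (Pos \<B>) R (cl_neg \<A> X) = up (Pos \<B>) R X"
proof
  show "up (Pos \<B>) R (cl_neg \<A> X) \<subseteq> up (Pos \<B>) R X"
    using X by (intro up_antimono subset_cl_neg)
  let ?Y = "up (Pos \<B>) R X"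
  have "X \<subseteq> down (Neg \<A>) R ?Y"
    using X by (auto simp: up_def down_def)
  from cl_neg_mono[OF this, of \<A>] have "cl_neg \<A> X \<subseteq> down (Neg \<A>) R ?Y"
    using compatible_down_closed[OF R, of ?Y] by (simp add: closed_neg_def up_subset)
  then show "?Y \<subseteq> up (Pos \<B>) R (cl_neg \<A> X)"
    by (auto simp: up_def down_def)
qed

text \<open>
  The membership condition in \<open>pol_comp\<close> refers to a column of the right factor. The next lemma moves
  it to a row of the left factor, so that the composite has the same shape from both sides.
\<close>

lemma up_pol_comp:
  assumes S: "compatible \<A> \<B> S" and R: "compatible \<B> \<C> R" and a: "a \<in> Neg \<A>"
  shows "up (Pos \<C>) (pol_comp \<A> \<B> \<C> S R) {a} =
         up (Pos \<C>) R (down (Neg \<B>) (Inc \<B>) (up (Pos \<B>) S {a}))"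
proof -
  let ?Z = "up (Pos \<B>) S {a}"
  have "(a, \<gamma>) \<in> pol_comp \<A> \<B> \<C> S R \<longleftrightarrow> down (Neg \<B>) (Inc \<B>) ?Z \<subseteq> down (Neg \<B>) R {\<gamma>}"
    if \<gamma>: "\<gamma> \<in> Pos \<C>" for \<gamma>
  proof -
    let ?W = "down (Neg \<B>) R {\<gamma>}"
    have Z: "up (Pos \<B>) (Inc \<B>) (down (Neg \<B>) (Inc \<B>) ?Z) = ?Z"
      using compatible_up_closed[OF S] a by (simp add: closed_pos_def cl_pos_def)
    have W: "down (Neg \<B>) (Inc \<B>) (up (Pos \<B>) (Inc \<B>) ?W) = ?W"
      using compatible_down_closed[OF R] \<gamma> by (simp add: closed_neg_def cl_neg_def)
    have "(a, \<gamma>) \<in> pol_comp \<A> \<B> \<C> S R \<longleftrightarrow> up (Pos \<B>) (Inc \<B>) ?W \<subseteq> ?Z"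
      using a \<gamma> by (auto simp: pol_comp_def down_def up_def)
    also have "\<dots> \<longleftrightarrow> down (Neg \<B>) (Inc \<B>) ?Z \<subseteq> ?W"
      using Z W down_antimono up_antimono by metis
    finally show ?thesis .
  qed
  then show ?thesis
    by (auto simp: up_def down_def)
qed

lemma pol_comp_subset: "pol_comp \<A> \<B> \<C> S R \<subseteq> Neg \<A> \<times> Pos \<C>"
  by (auto simp: pol_comp_def)

lemma relation_eqI_rows:
  assumes "S \<subseteq> A \<times> B" "T \<subseteq> A \<times> B" "\<And>a. a \<in> A \<Longrightarrow> up B S {a} = up B T {a}"
  shows "S = T"
  using assms unfolding up_def set_eq_iff by blast

lemma relation_eqI_columns:
  assumes "S \<subseteq> A \<times> B" "T \<subseteq> A \<times> B" "\<And>\<beta>. \<beta> \<in> B \<Longrightarrow> down A S {\<beta>} = down A T {\<beta>}"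
  shows "S = T"
  using assms unfolding down_def set_eq_iff by blast

section \<open>The test object\<close>

text \<open>
  The positive side has to be inhabited for the empty set to be closed on the negative side, and
  conversely: with one side empty, the whole other side is its only closed set.
\<close>

definition point :: "('x, 'y) polarity" where
  "point = \<lparr>Neg = {undefined}, Pos = {undefined}, Inc = {}\<rparr>"

lemma Neg_point [simp]: "Neg point = {undefined}" and Pos_point [simp]: "Pos point = {undefined}"
  by (simp_all add: point_def)

lemma is_polarity_point: "is_polarity point"
  by (simp add: is_polarity_def point_def)

lemma cl_neg_point: "X \<subseteq> {undefined} \<Longrightarrow> cl_neg point X = X"
  by (auto simp: point_def cl_neg_def down_def up_def)

lemma cl_pos_point: "Y \<subseteq> {undefined} \<Longrightarrow> cl_pos point Y = Y"
  by (auto simp: point_def cl_pos_def down_def up_def)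

lemma compatible_from_point:
  assumes "Z \<in> closed_pos \<B>"
  shows "compatible (point :: ('x, 'y) polarity) \<B> ({undefined} \<times> Z)"
proof -
  have Z: "Z \<subseteq> Pos \<B>" and cl: "cl_pos \<B> Z = Z"
    using assms by (simp_all add: closed_pos_def)
  have "cl_pos \<B> Y \<subseteq> Z \<longleftrightarrow> Y \<subseteq> Z" if "Y \<subseteq> Pos \<B>" for Y
    using cl cl_pos_mono[of Y Z \<B>] subset_cl_pos[OF that] by auto
  moreover have "down {undefined} ({undefined :: 'x} \<times> Z) Y = (if Y \<subseteq> Z then {undefined} else {})" for Y
    by (auto simp: down_def)
  ultimately show ?thesis
    using Z by (simp add: compatible_def cl_neg_point Sigma_mono)
qed

lemma compatible_to_point:
  assumes "W \<in> closed_neg \<C>"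
  shows "compatible \<C> (point :: ('x, 'y) polarity) (W \<times> {undefined})"
proof -
  have W: "W \<subseteq> Neg \<C>" and cl: "cl_neg \<C> W = W"
    using assms by (simp_all add: closed_neg_def)
  have "cl_neg \<C> (Neg \<C>) = Neg \<C>"
    using subset_cl_neg[of "Neg \<C>" \<C>] by (auto simp: cl_neg_def down_def)
  moreover have "down (Neg \<C>) (W \<times> {undefined}) Y = (if Y = {} then Neg \<C> else W)"
    if "Y \<subseteq> {undefined}" for Y :: "'y set"
    using W that by (auto simp: down_def)
  ultimately show ?thesis
    using W cl by (simp add: compatible_def cl_pos_point Sigma_mono)
qed

section \<open>Cancellation as injectivity on closed sets\<close>

lemma pol_mono_iff_inj_on:
  assumes R: "compatible \<B> \<C> R"
  shows "pol_mono TYPE(('x, 'y) polarity) \<B> \<C> R \<longleftrightarrow> inj_on (up (Pos \<C>) R) (closed_neg \<B>)"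
proof
  assume mono: "pol_mono TYPE(('x, 'y) polarity) \<B> \<C> R"
  show "inj_on (up (Pos \<C>) R) (closed_neg \<B>)"
  proof (rule inj_onI)
    let ?p = "point :: ('x, 'y) polarity"
    fix X X'
    assume X: "X \<in> closed_neg \<B>" and X': "X' \<in> closed_neg \<B>"
      and eq: "up (Pos \<C>) R X = up (Pos \<C>) R X'"
    \<comment> \<open>The morphism from the test object that represents a closed set.\<close>
    define P :: "'a set \<Rightarrow> ('x \<times> 'b) set" where
      "P V = {undefined} \<times> up (Pos \<B>) (Inc \<B>) V" for V
    have P: "compatible ?p \<B> (P V)" if "V \<in> closed_neg \<B>" for V
      unfolding P_def using that
      by (intro compatible_from_point up_Inc_closed) (simp add: closed_neg_def)
    have row: "up (Pos \<C>) (pol_comp ?p \<B> \<C> (P V) R) {a} = up (Pos \<C>) R V"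
      if V: "V \<in> closed_neg \<B>" and a: "a \<in> Neg ?p" for V a
    proof -
      have "up (Pos \<B>) (P V) {a} = up (Pos \<B>) (Inc \<B>) V"
        using a by (auto simp: P_def up_def)
      then show ?thesis
        using V by (simp add: up_pol_comp[OF P[OF V] R a] closed_neg_def cl_neg_def)
    qed
    have "pol_comp ?p \<B> \<C> (P X) R = pol_comp ?p \<B> \<C> (P X') R"
      by (rule relation_eqI_rows[where A = "Neg ?p" and B = "Pos \<C>"])
        (simp_all only: pol_comp_subset row[OF X] row[OF X'] eq)
    then have "P X = P X'"
      using mono P[OF X] P[OF X'] is_polarity_point unfolding pol_mono_def by blast
    then have "up (Pos \<B>) (Inc \<B>) X = up (Pos \<B>) (Inc \<B>) X'"
      by (auto simp: P_def)
    then show "X = X'"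
      using inj_on_up_Inc X X' by (auto dest: inj_onD)
  qed
next
  assume inj: "inj_on (up (Pos \<C>) R) (closed_neg \<B>)"
  show "pol_mono TYPE(('x, 'y) polarity) \<B> \<C> R"
    unfolding pol_mono_def
  proof (intro conjI allI impI)
    fix \<A> :: "('x, 'y) polarity" and S T
    assume S: "compatible \<A> \<B> S" and T: "compatible \<A> \<B> T"
      and eq: "pol_comp \<A> \<B> \<C> S R = pol_comp \<A> \<B> \<C> T R"
    show "S = T"
    proof (rule relation_eqI_rows)
      fix a assume a: "a \<in> Neg \<A>"
      let ?X = "\<lambda>U. down (Neg \<B>) (Inc \<B>) (up (Pos \<B>) U {a})"
      have "up (Pos \<C>) R (?X S) = up (Pos \<C>) R (?X T)"
        by (simp only: eq flip: up_pol_comp[OF S R a] up_pol_comp[OF T R a])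
      then have "?X S = ?X T"
        by (rule inj_onD[OF inj]) (simp_all add: down_Inc_closed up_subset)
      then show "up (Pos \<B>) S {a} = up (Pos \<B>) T {a}"
        by (rule inj_onD[OF inj_on_down_Inc])
          (use a in \<open>simp_all add: compatible_up_closed[OF S] compatible_up_closed[OF T]\<close>)
    qed (use S T in \<open>auto simp: compatible_def\<close>)
  qed (fact R)
qed

lemma pol_epi_iff_inj_on:
  assumes R: "compatible \<B> \<C> R"
  shows "pol_epi TYPE(('x, 'y) polarity) \<B> \<C> R \<longleftrightarrow> inj_on (down (Neg \<B>) R) (closed_pos \<C>)"
proof
  assume epi: "pol_epi TYPE(('x, 'y) polarity) \<B> \<C> R"
  show "inj_on (down (Neg \<B>) R) (closed_pos \<C>)"
  proof (rule inj_onI)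
    let ?p = "point :: ('x, 'y) polarity"
    fix Y Y'
    assume Y: "Y \<in> closed_pos \<C>" and Y': "Y' \<in> closed_pos \<C>"
      and eq: "down (Neg \<B>) R Y = down (Neg \<B>) R Y'"
    define Q :: "'d set \<Rightarrow> ('c \<times> 'y) set" where
      "Q V = down (Neg \<C>) (Inc \<C>) V \<times> {undefined}" for V
    have Q: "compatible \<C> ?p (Q V)" if "V \<in> closed_pos \<C>" for V
      unfolding Q_def using that
      by (intro compatible_to_point down_Inc_closed) (simp add: closed_pos_def)
    have column: "down (Neg \<B>) (pol_comp \<B> \<C> ?p R (Q V)) {\<delta>} = down (Neg \<B>) R V"
      if V: "V \<in> closed_pos \<C>" and \<delta>: "\<delta> \<in> Pos ?p" for V \<delta>
    proof -
      have "down (Neg \<C>) (Q V) {\<delta>} = down (Neg \<C>) (Inc \<C>) V"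
        using \<delta> by (auto simp: Q_def down_def)
      then show ?thesis
        using V \<delta> by (simp add: down_pol_comp[OF R Q[OF V]] closed_pos_def cl_pos_def)
    qed
    have "pol_comp \<B> \<C> ?p R (Q Y) = pol_comp \<B> \<C> ?p R (Q Y')"
      by (rule relation_eqI_columns[where A = "Neg \<B>" and B = "Pos ?p"])
        (simp_all only: pol_comp_subset column[OF Y] column[OF Y'] eq)
    then have "Q Y = Q Y'"
      using epi Q[OF Y] Q[OF Y'] is_polarity_point unfolding pol_epi_def by blast
    then have "down (Neg \<C>) (Inc \<C>) Y = down (Neg \<C>) (Inc \<C>) Y'"
      by (auto simp: Q_def)
    then show "Y = Y'"
      using inj_on_down_Inc Y Y' by (auto dest: inj_onD)
  qed
next
  assume inj: "inj_on (down (Neg \<B>) R) (closed_pos \<C>)"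
  show "pol_epi TYPE(('x, 'y) polarity) \<B> \<C> R"
    unfolding pol_epi_def
  proof (intro conjI allI impI)
    fix \<D> :: "('x, 'y) polarity" and S T
    assume S: "compatible \<C> \<D> S" and T: "compatible \<C> \<D> T"
      and eq: "pol_comp \<B> \<C> \<D> R S = pol_comp \<B> \<C> \<D> R T"
    show "S = T"
    proof (rule relation_eqI_columns)
      fix \<delta> assume \<delta>: "\<delta> \<in> Pos \<D>"
      let ?Y = "\<lambda>U. up (Pos \<C>) (Inc \<C>) (down (Neg \<C>) U {\<delta>})"
      have \<delta>': "{\<delta>} \<subseteq> Pos \<D>"
        using \<delta> by simp
      have "down (Neg \<B>) R (?Y S) = down (Neg \<B>) R (?Y T)"
        by (simp only: eq flip: down_pol_comp[OF R S \<delta>'] down_pol_comp[OF R T \<delta>'])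
      then have "?Y S = ?Y T"
        by (rule inj_onD[OF inj]) (simp_all add: up_Inc_closed down_subset)
      then show "down (Neg \<C>) S {\<delta>} = down (Neg \<C>) T {\<delta>}"
        by (rule inj_onD[OF inj_on_up_Inc])
          (use \<delta> in \<open>simp_all add: compatible_down_closed[OF S] compatible_down_closed[OF T]\<close>)
    qed (use S T in \<open>auto simp: compatible_def\<close>)
  qed (fact R)
qed

section \<open>Injectivity as a closure inequality\<close>

text \<open>
  If \<open>R\<^sup>\<up>\<close> is injective on closed sets, the two closed sets \<open>R\<^sup>\<down> R\<^sup>\<up> X\<close> and \<open>cl X\<close> must agree, because
  \<open>R\<^sup>\<up>\<close> sends both to \<open>R\<^sup>\<up> X\<close>. Conversely the inequality makes \<open>R\<^sup>\<down>\<close> a left inverse of \<open>R\<^sup>\<up>\<close> on closed sets.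
\<close>

lemma inj_on_up_iff:
  assumes R: "compatible \<B> \<C> R"
  shows "inj_on (up (Pos \<C>) R) (closed_neg \<B>) \<longleftrightarrow>
         (\<forall>X\<subseteq>Neg \<B>. down (Neg \<B>) R (up (Pos \<C>) R X) \<subseteq> cl_neg \<B> X)"
proof (intro iffI allI impI)
  fix X assume inj: "inj_on (up (Pos \<C>) R) (closed_neg \<B>)" and X: "X \<subseteq> Neg \<B>"
  have "down (Neg \<B>) R (up (Pos \<C>) R X) = cl_neg \<B> X"
    using X by (intro inj_onD[OF inj])
      (simp_all add: up_down_up compatible_up_cl_neg[OF R] compatible_down_closed[OF R]
        up_subset cl_neg_closed)
  then show "down (Neg \<B>) R (up (Pos \<C>) R X) \<subseteq> cl_neg \<B> X"
    by simp
next
  assume le: "\<forall>X\<subseteq>Neg \<B>. down (Neg \<B>) R (up (Pos \<C>) R X) \<subseteq> cl_neg \<B> X"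
  show "inj_on (up (Pos \<C>) R) (closed_neg \<B>)"
  proof (rule inj_on_inverseI)
    fix X assume "X \<in> closed_neg \<B>"
    then have X: "X \<subseteq> Neg \<B>" and cl: "cl_neg \<B> X = X"
      by (auto simp: closed_neg_def)
    have "X \<subseteq> down (Neg \<B>) R (up (Pos \<C>) R X)"
      using X by (auto simp: up_def down_def)
    with le X cl show "down (Neg \<B>) R (up (Pos \<C>) R X) = X"
      by auto
  qed
qed

lemma inj_on_down_iff:
  assumes R: "compatible \<B> \<C> R"
  shows "inj_on (down (Neg \<B>) R) (closed_pos \<C>) \<longleftrightarrow>
         (\<forall>Y\<subseteq>Pos \<C>. up (Pos \<C>) R (down (Neg \<B>) R Y) \<subseteq> cl_pos \<C> Y)"
proof (intro iffI allI impI)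
  fix Y assume inj: "inj_on (down (Neg \<B>) R) (closed_pos \<C>)" and Y: "Y \<subseteq> Pos \<C>"
  have "up (Pos \<C>) R (down (Neg \<B>) R Y) = cl_pos \<C> Y"
    using Y by (intro inj_onD[OF inj])
      (simp_all add: down_up_down compatible_down_cl_pos[OF R] compatible_up_closed[OF R]
        down_subset cl_pos_closed)
  then show "up (Pos \<C>) R (down (Neg \<B>) R Y) \<subseteq> cl_pos \<C> Y"
    by simp
next
  assume le: "\<forall>Y\<subseteq>Pos \<C>. up (Pos \<C>) R (down (Neg \<B>) R Y) \<subseteq> cl_pos \<C> Y"
  show "inj_on (down (Neg \<B>) R) (closed_pos \<C>)"
  proof (rule inj_on_inverseI)
    fix Y assume "Y \<in> closed_pos \<C>"
    then have Y: "Y \<subseteq> Pos \<C>" and cl: "cl_pos \<C> Y = Y"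
      by (auto simp: closed_pos_def)
    have "Y \<subseteq> up (Pos \<C>) R (down (Neg \<B>) R Y)"
      using Y by (auto simp: up_def down_def)
    with le Y cl show "up (Pos \<C>) R (down (Neg \<B>) R Y) = Y"
      by auto
  qed
qed

theorem lemma2p12:
  fixes \<B> :: "('a, 'b) polarity" and \<C> :: "('c, 'd) polarity" and R :: "('a \<times> 'd) set"
  assumes "is_polarity \<B>" and "is_polarity \<C>" and "compatible \<B> \<C> R"
  shows "(pol_mono TYPE(('x, 'y) polarity) \<B> \<C> R \<longleftrightarrow>
            (\<forall>X\<subseteq>Neg \<B>. down (Neg \<B>) R (up (Pos \<C>) R X) \<subseteq> cl_neg \<B> X)) \<and>
         (pol_epi TYPE(('z, 'w) polarity) \<B> \<C> R \<longleftrightarrow>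
            (\<forall>Y\<subseteq>Pos \<C>. cl_pos \<C> Y \<supseteq> up (Pos \<C>) R (down (Neg \<B>) R Y)))"
  using assms(3)
  by (simp add: pol_mono_iff_inj_on inj_on_up_iff pol_epi_iff_inj_on inj_on_down_iff)

end
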